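(* Let $X,Y$ be LCTV spaces, $\phi\colon X\times Y\to\overline{\mathbb R}$ a function, $F\colon X\rightrightarrows Y$ a set-valued mapping, and let $\mu(x):=\inf\{\phi(x,y)\mid y\in F(x)\}$ for $x\in X$. Let $x_0\in X$ with $\mu(x_0)\in\mathbb R$. Suppose that $F$ is lower semicontinuous at $x_0$ and that $\phi$ is upper semicontinuous at every point $(x_0,y)$ with $y\in F(x_0)$. Then $\mu$ is upper semicontinuous at $x_0$.
   Context: LCTV space means real locally convex Hausdorff topological vector space. $\overline{\mathbb R}=\mathbb R\cup\{-\infty\}\cup\{\infty\}$ and $\inf\emptyset=\infty$. A function $f\colon X\to\overline{\mathbb R}$ is lower semicontinuous at $x_0$ if for each real $\lambda<f(x_0)$ there is a neighborhood $V$ of $x_0$ with $\lambda<f(x)$ for all $x\in V$; $f$ is upper semicontinuous at $x_0$ if $-f$ is lower semicontinuous at $x_0$. A set-valued mapping $F\colon X\rightrightarrows Y$ is lower semicontinuous at $x_0$ (with $F(x_0)\neq\emptyset$) if for any open $V\subset Y$ with $F(x_0)\cap V\ne\emptyset$ there is a neighborhood $U$ of $x_0$ such that $F(x)\cap V\neq\emptyset$ for all $x\in U$. *)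

theory Defs
  imports "HOL-Analysis.Analysis"
begin

text \<open>Real locally convex Hausdorff topological vector spaces. A class specification
  cannot use \<open>convex\<close>, \<open>locally\<close> or the product topology (they need sort constraints on the class
  parameter), so the axioms are unfolded; the two lemmas below give the library form: joint
  continuity of scalar multiplication, and \<open>locally convex UNIV\<close>.\<close>

class lctv_space = real_vector + topological_ab_group_add + t2_space +
  assumes tendsto_scaleR_pair:
      "((\<lambda>p. scaleR (fst p) (snd p)) \<longlongrightarrow> scaleR c x) (nhds c \<times>\<^sub>F nhds x)"
    and convex_nhds_base:
      "\<lbrakk>open U; x \<in> U\<rbrakk> \<Longrightarrow> \<exists>V. V \<subseteq> U \<and> (\<forall>\<^sub>F z in nhds x. z \<in> V) \<and>
        (\<forall>y\<in>V. \<forall>z\<in>V. \<forall>u\<ge>0. \<forall>v\<ge>0. u + v = 1 \<longrightarrow> scaleR u y + scaleR v z \<in> V)"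

lemma continuous_on_scaleR_pair:
  "continuous_on UNIV (\<lambda>(c, x::'a::lctv_space). c *\<^sub>R x)"
proof -
  have "isCont (\<lambda>p. fst p *\<^sub>R snd p) (c, x)" for c and x :: 'a
    using tendsto_scaleR_pair[of c x]
      tendsto_at_iff_tendsto_nhds[of "\<lambda>p. fst p *\<^sub>R snd p" "(c, x)"]
    by (simp add: nhds_prod continuous_at)
  then show ?thesis
    by (auto simp: continuous_on_eq_continuous_at case_prod_unfold)
qed

lemma locally_convex_UNIV: "locally convex (UNIV :: 'a::lctv_space set)"
proof (rule locallyI)
  fix w :: "'a set" and x
  assume "openin (top_of_set UNIV) w" "x \<in> w"
  then obtain V where "V \<subseteq> w" "\<forall>\<^sub>F z in nhds x. z \<in> V" "convex V"
    using convex_nhds_base[of w x] unfolding convex_def by auto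
  then show "\<exists>u v. openin (top_of_set UNIV) u \<and> convex v \<and> x \<in> u \<and> u \<subseteq> v \<and> v \<subseteq> w"
    by (auto simp: eventually_nhds)
qed

instance real_normed_vector \<subseteq> lctv_space
proof
  fix c :: real and x :: 'a and U :: "'a set"
  show "((\<lambda>p. fst p *\<^sub>R snd p) \<longlongrightarrow> c *\<^sub>R x) (nhds c \<times>\<^sub>F nhds x)"
    by (intro tendsto_scaleR filterlim_fst filterlim_snd)
  assume "open U" "x \<in> U"
  then obtain e where e: "e > 0" "ball x e \<subseteq> U"
    by (auto simp: open_contains_ball)
  then have "\<forall>\<^sub>F z in nhds x. z \<in> ball x e"
    by (intro eventually_nhds_in_open) auto
  with e show "\<exists>V. V \<subseteq> U \<and> (\<forall>\<^sub>F z in nhds x. z \<in> V) \<and>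
      (\<forall>y\<in>V. \<forall>z\<in>V. \<forall>u\<ge>0. \<forall>v\<ge>0. u + v = 1 \<longrightarrow> u *\<^sub>R y + v *\<^sub>R z \<in> V)"
    using convex_ball[of x e] unfolding convex_def by blast
qed

definition lsc_at :: "('a::topological_space \<Rightarrow> ereal) \<Rightarrow> 'a \<Rightarrow> bool" where
  "lsc_at f x0 \<longleftrightarrow>
    (\<forall>l::real. ereal l < f x0 \<longrightarrow> (\<forall>\<^sub>F x in nhds x0. ereal l < f x))"

definition usc_at :: "('a::topological_space \<Rightarrow> ereal) \<Rightarrow> 'a \<Rightarrow> bool" where
  "usc_at f x0 \<longleftrightarrow> lsc_at (\<lambda>x. - f x) x0"

text \<open>Lower semicontinuity of a set-valued mapping at a point of its domain.\<close>

definition set_lsc_at ::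
    "('a::topological_space \<Rightarrow> 'b::topological_space set) \<Rightarrow> 'a \<Rightarrow> bool" where
  "set_lsc_at F x0 \<longleftrightarrow> F x0 \<noteq> {} \<and>
    (\<forall>V. open V \<longrightarrow> F x0 \<inter> V \<noteq> {} \<longrightarrow> (\<forall>\<^sub>F x in nhds x0. F x \<inter> V \<noteq> {}))"

text \<open>On \<open>ereal\<close> the infimum over the empty set is \<open>\<infinity>\<close>.\<close>

definition marginal :: "('a \<times> 'b \<Rightarrow> ereal) \<Rightarrow> ('a \<Rightarrow> 'b set) \<Rightarrow> 'a \<Rightarrow> ereal" where
  "marginal \<phi> F x = (INF y\<in>F x. \<phi> (x, y))"

end

theory Submission
  imports Defs
begin

text \<open>Every real bound above \<open>\<mu> x0\<close> is already beaten by one value \<open>\<phi> (x0, y)\<close> with \<open>y \<in> F x0\<close>.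
  Upper semicontinuity of \<open>\<phi>\<close> at this single point keeps the values below the bound on a box
  \<open>U \<times> V\<close> around \<open>(x0, y)\<close>, and lower semicontinuity of \<open>F\<close> says that for \<open>x\<close> near \<open>x0\<close> the set
  \<open>F x\<close> still meets \<open>V\<close>; any point where it does witnesses that \<open>\<mu> x\<close> is below the bound.\<close>

text \<open>This trades the sign change for a bound from above, the form in which an infimum is
  estimated.\<close>

lemma usc_at_iff_eventually_less:
  "usc_at f x0 \<longleftrightarrow> (\<forall>m::real. f x0 < ereal m \<longrightarrow> (\<forall>\<^sub>F x in nhds x0. f x < ereal m))"
proof -
  have flip: "ereal l < - t \<longleftrightarrow> t < ereal (- l)" for l and t :: ereal
    by (cases t) auto
  have surj_uminus: "(\<forall>l::real. P (- l)) \<longleftrightarrow> (\<forall>m. P m)" for P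
    by (metis minus_minus)
  show ?thesis
    unfolding usc_at_def lsc_at_def flip
    by (rule surj_uminus[of "\<lambda>m. f x0 < ereal m \<longrightarrow> (\<forall>\<^sub>F x in nhds x0. f x < ereal m)"])
qed

lemma usc_at_marginal:
  fixes \<phi> :: "'a::topological_space \<times> 'b::topological_space \<Rightarrow> ereal"
  assumes F: "set_lsc_at F x0"
    and \<phi>: "\<And>y. y \<in> F x0 \<Longrightarrow> usc_at \<phi> (x0, y)"
  shows "usc_at (marginal \<phi> F) x0"
  unfolding usc_at_iff_eventually_less
proof (intro allI impI)
  fix m :: real
  assume "marginal \<phi> F x0 < ereal m"
  then obtain y where y: "y \<in> F x0" "\<phi> (x0, y) < ereal m"
    by (auto simp: marginal_def INF_less_iff)
  then have "\<forall>\<^sub>F p in nhds (x0, y). \<phi> p < ereal m"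
    using \<phi> by (simp add: usc_at_iff_eventually_less)
  then obtain S where S: "open S" "(x0, y) \<in> S" "\<And>p. p \<in> S \<Longrightarrow> \<phi> p < ereal m"
    by (auto simp: eventually_nhds)
  from S(1,2) obtain U V where "open U" "open V" "(x0, y) \<in> U \<times> V" "U \<times> V \<subseteq> S"
    by (rule open_prod_elim)
  then have UV: "open U" "open V" "x0 \<in> U" "y \<in> V" "U \<times> V \<subseteq> S"
    by simp_all
  have "\<forall>\<^sub>F x in nhds x0. F x \<inter> V \<noteq> {}"
    using F y(1) UV(2,4) unfolding set_lsc_at_def by blast
  moreover have "\<forall>\<^sub>F x in nhds x0. x \<in> U"
    using UV by (intro eventually_nhds_in_open)
  ultimately show "\<forall>\<^sub>F x in nhds x0. marginal \<phi> F x < ereal m"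
  proof eventually_elim
    case (elim x)
    then obtain z where "z \<in> F x" "\<phi> (x, z) < ereal m"
      using S(3) UV(5) by blast
    then show ?case
      by (auto simp: marginal_def INF_less_iff)
  qed
qed

theorem proposition4p6:
  fixes \<phi> :: "'a::lctv_space \<times> 'b::lctv_space \<Rightarrow> ereal"
    and F :: "'a \<Rightarrow> 'b set"
    and x0 :: 'a
  assumes "\<bar>marginal \<phi> F x0\<bar> \<noteq> \<infinity>"
    and "set_lsc_at F x0"
    and "\<And>y. y \<in> F x0 \<Longrightarrow> usc_at \<phi> (x0, y)"
  shows "usc_at (marginal \<phi> F) x0"
  using assms(2,3) by (rule usc_at_marginal)

end
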